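(* Let $X$ be a Banach space over $\mathbb{R}$ or $\mathbb{C}$, and let $X_1\subset X_2\subset\cdots\subset X$ be closed (not necessarily finite-dimensional) subspaces with $X=\overline{\bigcup_{m=1}^{\infty}X_m}$. Suppose that for every $m\in\mathbb{N}$ there is a continuous linear projection $P_m$ from $X$ onto $X_m$ with $\|P_m\|=1$, and that these projections satisfy $P_m(P_jx)=P_mx$ for all $x\in X$ and all $j\ge m$. Let $n_1(X)$ and $n_1(X_m)$ be the modified numerical indices defined by means of these projections. Then $$n_1(X)=\lim_{m\to\infty} n_1(X_m).$$
   Context: For a Banach space $Z$, $S_Z$ denotes its unit sphere, $Z^*$ its dual, and $\mathcal{L}(Z)$ the space of bounded linear operators on $Z$ with the operator norm. Modified numerical index. For $L\in\mathcal{L}(X_m)$ put $$n_1(L)=\sup\{|x^*(P_jLP_jx)| : j\in\{1,2,\ldots,m\},\ x^*\in S_{X^*},\ x\in S_X,\ x^*(x)=1\},$$ $$n_1(X_m)=\inf\{n_1(L): L\in\mathcal{L}(X_m),\ \|L\|=1\}.$$ (Note that $P_jx\in X_j\subset X_m$ for $j\le m$, so $LP_jx$ makes sense.) For $L\in\mathcal{L}(X)$ put $$n_1(L)=\sup\{|x^*(P_jLP_jx)| : j\in\mathbb{N},\ x^*\in S_{X^*},\ x\in S_X,\ x^*(x)=1\},$$ $$n_1(X)=\inf\{n_1(L): L\in\mathcal{L}(X),\ \|L\|=1\}.$$ *)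

theory Defs
  imports "HOL-Analysis.Analysis"
begin

text \<open>
  The scalar fields \<open>\<real>\<close> and \<open>\<complex>\<close>. The norm of \<^class>\<open>real_normed_field\<close> is multiplicative
  and extends the absolute value of the reals, so in the second case it is the usual modulus.
\<close>

class real_or_complex = real_normed_field +
  assumes real_or_complex:
    "(\<forall>x. \<exists>a. x = a *\<^sub>R 1) \<or>
     (\<exists>i. i * i = - 1 \<and> (\<forall>x. \<exists>a b. x = a *\<^sub>R 1 + b *\<^sub>R i))"

instance real :: real_or_complex
  by standard simp

instance complex :: real_or_complex
proof
  have "\<exists>a b. x = a *\<^sub>R 1 + b *\<^sub>R \<i>" for x :: complex
    by (rule exI[of _ "Re x"], rule exI[of _ "Im x"]) (simp add: complex_eq_iff)
  then show "(\<forall>x::complex. \<exists>a. x = a *\<^sub>R 1) \<or>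
     (\<exists>i::complex. i * i = - 1 \<and> (\<forall>x. \<exists>a b. x = a *\<^sub>R 1 + b *\<^sub>R i))"
    by (intro disjI2 exI[of _ "\<i>"]) simp
qed

text \<open>
  A normed space over \<open>'k\<close> is a real normed space together with a multiplication by
  scalars from \<open>'k\<close> that extends \<^const>\<open>scaleR\<close>. Completeness is left to the class \<^class>\<open>banach\<close>.
\<close>

locale normed_space_over = vector_space smul
  for smul :: "'k::real_or_complex \<Rightarrow> 'a::real_normed_vector \<Rightarrow> 'a" +
  assumes norm_smul: "norm (smul c x) = norm c * norm x"
    and smul_of_real: "smul (of_real r) x = r *\<^sub>R x"

lemma normed_space_over_scaleR:
  "normed_space_over (scaleR :: real \<Rightarrow> 'a::real_normed_vector \<Rightarrow> 'a)"
  by unfold_locales (auto simp: algebra_simps)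

lemma normed_space_over_mult:
  "normed_space_over ((*) :: 'k \<Rightarrow> 'k \<Rightarrow> 'k::real_or_complex)"
  by unfold_locales (auto simp: algebra_simps norm_mult scaleR_conv_of_real)

text \<open>
  Operators between subspaces \<open>A\<close> and \<open>B\<close> are represented by functions on the ambient type
  whose values outside \<open>A\<close> are irrelevant.
\<close>

definition bounded_linear_between ::
  "('k \<Rightarrow> 'a \<Rightarrow> 'a) \<Rightarrow> ('k \<Rightarrow> 'b \<Rightarrow> 'b) \<Rightarrow> 'a set \<Rightarrow> 'b set \<Rightarrow>
    ('a::real_normed_vector \<Rightarrow> 'b::real_normed_vector) \<Rightarrow> bool" where
  "bounded_linear_between smul smul' A B T \<longleftrightarrow>
     T ` A \<subseteq> B \<and>
     (\<forall>x\<in>A. \<forall>y\<in>A. T (x + y) = T x + T y) \<and>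
     (\<forall>c. \<forall>x\<in>A. T (smul c x) = smul' c (T x)) \<and>
     (\<exists>K. \<forall>x\<in>A. norm (T x) \<le> norm x * K)"

text \<open>The operator norm of an operator with domain \<open>A\<close>, following \<^const>\<open>onorm\<close>.\<close>

definition onorm_on ::
  "'a set \<Rightarrow> ('a::real_normed_vector \<Rightarrow> 'b::real_normed_vector) \<Rightarrow> real" where
  "onorm_on A T = (SUP x\<in>A. norm (T x) / norm x)"

lemma onorm_on_UNIV: "onorm_on UNIV T = onorm T"
  by (simp add: onorm_on_def onorm_def)

lemma bounded_linear_between_UNIV:
  assumes "normed_space_over smul" "normed_space_over smul'"
  shows "bounded_linear_between smul smul' UNIV UNIV T \<longleftrightarrow>
    Vector_Spaces.linear smul smul' T \<and> bounded_linear T"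
proof -
  interpret V: normed_space_over smul by fact
  interpret W: normed_space_over smul' by fact
  have scaleR: "T (r *\<^sub>R x) = r *\<^sub>R T x" if "\<forall>c x. T (smul c x) = smul' c (T x)" for r x
    using that by (metis V.smul_of_real W.smul_of_real)
  have "Vector_Spaces.linear smul smul' T \<longleftrightarrow>
      (\<forall>x y. T (x + y) = T x + T y) \<and> (\<forall>c x. T (smul c x) = smul' c (T x))"
    by (simp add: Vector_Spaces.linear_def module_hom_def module_hom_axioms_def
        V.vector_space_axioms W.vector_space_axioms V.module_axioms W.module_axioms)
  then show ?thesis
    unfolding bounded_linear_between_def bounded_linear_def bounded_linear_axioms_def linear_iff
    using scaleR by auto
qed

definition dual_sphere ::
  "('k::real_or_complex \<Rightarrow> 'a \<Rightarrow> 'a) \<Rightarrow> ('a::real_normed_vector \<Rightarrow> 'k) set" where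
  "dual_sphere smul = {f. bounded_linear_between smul (*) UNIV UNIV f \<and> onorm f = 1}"

text \<open>
  For an operator \<open>L\<close> on the subspace \<open>X m\<close> the index set \<open>J\<close> is \<open>{1..m}\<close>, for an operator on
  the whole space it is \<open>{1..}\<close>. In both cases the pairs \<open>(x, f)\<close> are taken from the whole
  space and its dual.
\<close>

definition n1_op ::
  "('k::real_or_complex \<Rightarrow> 'a \<Rightarrow> 'a) \<Rightarrow> (nat \<Rightarrow> 'a \<Rightarrow> 'a) \<Rightarrow> nat set \<Rightarrow>
    ('a::real_normed_vector \<Rightarrow> 'a) \<Rightarrow> real" where
  "n1_op smul P J L =
     Sup {norm (f (P j (L (P j x)))) | j f x.
            j \<in> J \<and> f \<in> dual_sphere smul \<and> x \<in> sphere 0 1 \<and> f x = 1}"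

definition n1_index ::
  "('k::real_or_complex \<Rightarrow> 'a \<Rightarrow> 'a) \<Rightarrow> (nat \<Rightarrow> 'a \<Rightarrow> 'a) \<Rightarrow> nat set \<Rightarrow>
    'a::real_normed_vector set \<Rightarrow> real" where
  "n1_index smul P J Y =
     Inf {n1_op smul P J L | L.
            bounded_linear_between smul smul Y Y L \<and> onorm_on Y L = 1}"

end

theory Submission
  imports Defs
begin

text \<open>
  An operator \<open>L\<close> on \<open>X m\<close> extends to \<open>L \<circ> P m\<close> on the whole space with the same norm and,
  since \<open>P j\<close> and \<open>P m\<close> compose to \<open>P (min j m)\<close>, with the same modified numerical radius; hence
  \<open>n1(X) \<le> n1(X m)\<close>. Conversely an operator \<open>L\<close> on the whole space compresses to \<open>P m \<circ> L\<close> on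
  \<open>X m\<close> without increasing the numerical radius, and as \<open>P m\<close> converges strongly to the identity
  the norms of the compressions tend to \<open>\<parallel>L\<parallel>\<close>; normalising the compressions gives
  \<open>limsup n1(X m) \<le> n1(X)\<close>.
\<close>

section \<open>Operator norms on a domain\<close>

text \<open>Boundedness of the operator bounds the quotients, so the real \<open>SUP\<close> is a
  genuine upper bound. At zero the quotient is 0 by convention, and there \<open>K\<close> forces
  \<open>T x = 0\<close>.\<close>

lemma onorm_on_bound:
  assumes "bounded_linear_between s s' A B T" "x \<in> A"
  shows "norm (T x) \<le> onorm_on A T * norm x"
proof -
  obtain K where K: "\<And>y. y \<in> A \<Longrightarrow> norm (T y) \<le> norm y * K"
    using assms(1) unfolding bounded_linear_between_def by blast
  \<comment> \<open>The absolute value is needed when \<open>A\<close> contains only zero: then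
    \<open>K\<close> may be negative while the quotient is 0.\<close>
  have "norm (T y) / norm y \<le> \<bar>K\<bar>" if "y \<in> A" for y
  proof (cases "norm y = 0")
    case False
    then have "norm (T y) / norm y \<le> K"
      using K[OF that] by (simp add: divide_simps mult.commute)
    then show ?thesis by simp
  qed simp
  then have "bdd_above ((\<lambda>y. norm (T y) / norm y) ` A)"
    by (intro bdd_aboveI2) auto
  then have "norm (T x) / norm x \<le> onorm_on A T"
    unfolding onorm_on_def by (rule cSUP_upper[OF assms(2)])
  then show ?thesis
    using K[OF assms(2)] by (cases "norm x = 0") (auto simp: divide_simps)
qed

lemma onorm_on_le:
  assumes "A \<noteq> {}" "0 \<le> b" "\<And>x. x \<in> A \<Longrightarrow> norm (T x) \<le> b * norm x"
  shows "onorm_on A T \<le> b"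
  unfolding onorm_on_def
proof (rule cSUP_least[OF assms(1)])
  show "norm (T x) / norm x \<le> b" if "x \<in> A" for x
    using assms(2) assms(3)[OF that] by (cases "norm x = 0") (auto simp: divide_simps)
qed

section \<open>States and operators of norm one\<close>

context normed_space_over
begin

text \<open>The same pairs enter every \<open>n1_op\<close>, whatever the operator and the index
  set, so whether there are any can be treated once for all suprema.\<close>

definition states :: "(('a \<Rightarrow> 'k) \<times> 'a) set" where
  "states = {(f, x). f \<in> dual_sphere smul \<and> x \<in> sphere 0 1 \<and> f x = 1}"

definition unit_operators :: "'a set \<Rightarrow> ('a \<Rightarrow> 'a) set" where
  "unit_operators Y = {L. bounded_linear_between smul smul Y Y L \<and> onorm_on Y L = 1}"

lemma n1_op_eq:
  "n1_op smul P J L = Sup {norm (f (P j (L (P j x)))) | j f x. j \<in> J \<and> (f, x) \<in> states}"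
  by (simp add: n1_op_def states_def)

lemma n1_index_eq: "n1_index smul P J Y = Inf (n1_op smul P J ` unit_operators Y)"
  unfolding n1_index_def unit_operators_def by (rule arg_cong[of _ _ Inf]) auto

lemma dual_sphere_bounds:
  assumes "f \<in> dual_sphere smul"
  shows norm_dual_sphere_le: "norm (f y) \<le> norm y"
    and norm_dual_sphere_scaleR: "norm (f (r *\<^sub>R y)) = \<bar>r\<bar> * norm (f y)"
proof -
  have f: "bounded_linear_between smul (*) UNIV UNIV f" "onorm f = 1"
    using assms by (auto simp: dual_sphere_def)
  show "norm (f y) \<le> norm y"
    using onorm_on_bound[OF f(1), of y] f(2) by (simp add: onorm_on_UNIV)
  have "bounded_linear f"
    using f(1) bounded_linear_between_UNIV[OF normed_space_over_axioms normed_space_over_mult]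
    by blast
  then show "norm (f (r *\<^sub>R y)) = \<bar>r\<bar> * norm (f y)"
    by (simp add: linear_simps)
qed

lemma id_in_unit_operators:
  assumes "x \<in> Y" "x \<noteq> 0"
  shows "(\<lambda>x. x) \<in> unit_operators Y"
proof -
  have blb: "bounded_linear_between smul smul Y Y (\<lambda>x. x)"
    unfolding bounded_linear_between_def by (auto intro: exI[of _ 1])
  have "onorm_on Y (\<lambda>x. x) \<le> 1"
    using assms by (intro onorm_on_le) auto
  moreover have "1 \<le> onorm_on Y (\<lambda>x. x)"
    using onorm_on_bound[OF blb assms(1)] assms(2) by simp
  ultimately show ?thesis
    using blb by (simp add: unit_operators_def)
qed

end

section \<open>Nested ranges and strong convergence of the projections\<close>

locale projection_filtration = normed_space_over smul
  for smul :: "'k::real_or_complex \<Rightarrow> 'a::real_normed_vector \<Rightarrow> 'a" +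
  fixes X :: "nat \<Rightarrow> 'a set" and P :: "nat \<Rightarrow> 'a \<Rightarrow> 'a"
  assumes subspace_X: "m \<ge> 1 \<Longrightarrow> subspace (X m)"
    and X_Suc: "m \<ge> 1 \<Longrightarrow> X m \<subseteq> X (Suc m)"
    and dense: "closure (\<Union>m\<in>{1..}. X m) = UNIV"
    and P_between: "m \<ge> 1 \<Longrightarrow> bounded_linear_between smul smul UNIV UNIV (P m)"
    and range_P: "m \<ge> 1 \<Longrightarrow> range (P m) = X m"
    and P_idem: "m \<ge> 1 \<Longrightarrow> P m (P m x) = P m x"
    and onorm_P: "m \<ge> 1 \<Longrightarrow> onorm (P m) = 1"
    and P_absorb: "m \<ge> 1 \<Longrightarrow> j \<ge> m \<Longrightarrow> P m (P j x) = P m x"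
begin

lemma X_mono:
  assumes "1 \<le> m" "m \<le> j"
  shows "X m \<subseteq> X j"
  using assms(2)
proof (induction rule: dec_induct)
  case (step n)
  then show ?case using X_Suc[of n] assms(1) by auto
qed simp

lemma P_in_X: "1 \<le> m \<Longrightarrow> P m x \<in> X m"
  using range_P by auto

text \<open>A projection is the identity on its range, and the range of \<open>P j\<close> contains
  every earlier subspace.\<close>

lemma P_fixes:
  assumes "1 \<le> m" "m \<le> j" "x \<in> X m"
  shows "P j x = x"
proof -
  have "x \<in> range (P j)"
    using X_mono[OF assms(1,2)] range_P[of j] assms by auto
  then show ?thesis using P_idem[of j] assms(1,2) by auto
qed

lemma bounded_linear_P: "1 \<le> m \<Longrightarrow> bounded_linear (P m)"
  using P_between bounded_linear_between_UNIV[OF normed_space_over_axioms normed_space_over_axioms]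
  by blast

lemma P_smul: "1 \<le> m \<Longrightarrow> P m (smul c x) = smul c (P m x)"
  using P_between[of m] by (simp add: bounded_linear_between_def)

lemma norm_P_le: "1 \<le> m \<Longrightarrow> norm (P m x) \<le> norm x"
  using onorm[OF bounded_linear_P, of m x] onorm_P by simp

text \<open>On the dense union the sequence is eventually constant; since all \<open>P m\<close> are
  contractions, convergence carries over to the closure.\<close>

lemma P_tendsto: "(\<lambda>m. P m x) \<longlonglongrightarrow> x"
proof (rule LIMSEQ_I)
  fix r :: real assume "0 < r"
  then obtain y k where y: "1 \<le> k" "y \<in> X k" "dist y x < r / 2"
    using dense closure_approachable[of x "\<Union>m\<in>{1..}. X m"] by (force dest: spec[of _ "r / 2"])
  have "norm (P m x - x) < r" if "k \<le> m" for m
  proof -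
    have m: "1 \<le> m" using y(1) that by simp
    have "P m x - x = P m (x - y) + (y - x)"
      using P_fixes[OF y(1) that y(2)] bounded_linear_P[OF m] by (simp add: linear_simps)
    also have "norm \<dots> \<le> norm (x - y) + norm (y - x)"
      using norm_P_le[OF m] norm_triangle_le by (metis add_right_mono)
    also have "\<dots> < r"
      using y(3) by (simp add: dist_norm norm_minus_commute)
    finally show ?thesis .
  qed
  then show "\<exists>no. \<forall>m\<ge>no. norm (P m x - x) < r" by blast
qed

text \<open>Otherwise \<open>P m\<close> would be the zero operator, whose norm is 0 and not
  1.\<close>

lemma X_nontrivial:
  assumes "1 \<le> m"
  obtains x where "x \<in> X m" "x \<noteq> 0"
proof (rule ccontr)
  assume "\<not> thesis"
  then have "P m = (\<lambda>x. 0)"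
    using P_in_X[OF assms] that by blast
  then show False
    using onorm_P[OF assms] by (simp add: onorm_zero)
qed

lemma unit_operators_X_nonempty: "1 \<le> m \<Longrightarrow> unit_operators (X m) \<noteq> {}"
  by (metis X_nontrivial id_in_unit_operators empty_iff)

lemma unit_operators_UNIV_nonempty: "unit_operators UNIV \<noteq> {}"
  by (metis X_nontrivial[of 1] id_in_unit_operators UNIV_I empty_iff order_refl)

section \<open>Modified numerical radius and index as bounded suprema and infima\<close>

text \<open>States and projections do not increase norms, so all values are bounded by the norm of
  \<open>L\<close>. The condition on \<open>J\<close> covers both \<open>{1..m}\<close> with
  \<open>X m\<close> and \<open>{1..}\<close> with \<open>UNIV\<close>.\<close>

lemma n1_op_upper:
  assumes L: "bounded_linear_between smul smul Y Y L"
    and J: "\<And>j. j \<in> J \<Longrightarrow> 1 \<le> j \<and> X j \<subseteq> Y"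
    and j: "j \<in> J" "(f, x) \<in> states"
  shows "norm (f (P j (L (P j x)))) \<le> n1_op smul P J L"
proof -
  have "norm (f (P j (L (P j x)))) \<le> \<bar>onorm_on Y L\<bar>" if "j \<in> J" "(f, x) \<in> states" for j f x
  proof -
    have j1: "1 \<le> j" and Px: "P j x \<in> Y" using J[OF that(1)] P_in_X by auto
    have f: "f \<in> dual_sphere smul" and x: "norm x = 1"
      using that(2) by (auto simp: states_def)
    have "norm (f (P j (L (P j x)))) \<le> norm (L (P j x))"
      using norm_dual_sphere_le[OF f] norm_P_le[OF j1] order_trans by blast
    also have "\<dots> \<le> onorm_on Y L * norm (P j x)" by (rule onorm_on_bound[OF L Px])
    \<comment> \<open>With the absolute value, monotonicity of the product applies without first
      proving the norm nonnegative.\<close>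
    also have "\<dots> \<le> \<bar>onorm_on Y L\<bar> * norm x"
      using norm_P_le[OF j1] by (intro mult_mono) auto
    finally show ?thesis using x by simp
  qed
  then have "bdd_above {norm (f (P j (L (P j x)))) | j f x. j \<in> J \<and> (f, x) \<in> states}"
    by (intro bdd_aboveI[of _ "\<bar>onorm_on Y L\<bar>"]) auto
  then show ?thesis
    unfolding n1_op_eq using j by (intro cSup_upper) blast+
qed

lemma n1_op_least:
  assumes "J \<noteq> {}" "states \<noteq> {}"
    and "\<And>j f x. j \<in> J \<Longrightarrow> (f, x) \<in> states \<Longrightarrow> norm (f (P j (L (P j x)))) \<le> b"
  shows "n1_op smul P J L \<le> b"
  unfolding n1_op_eq by (rule cSup_least) (use assms in \<open>auto simp: ex_in_conv[symmetric]\<close>)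

lemma n1_op_nonneg:
  assumes "J \<noteq> {}" "states \<noteq> {}"
    and "bounded_linear_between smul smul Y Y L"
    and "\<And>j. j \<in> J \<Longrightarrow> 1 \<le> j \<and> X j \<subseteq> Y"
  shows "0 \<le> n1_op smul P J L"
proof -
  obtain j f x where "j \<in> J" "(f, x) \<in> states" using assms(1,2) by fastforce
  then show ?thesis
    using n1_op_upper[OF assms(3,4)] norm_ge_zero order_trans by blast
qed

text \<open>Numerical radii are nonnegative once a state exists, so the real \<open>Inf\<close> is a
  genuine lower bound.\<close>

lemma n1_index_lower:
  assumes "J \<noteq> {}" "states \<noteq> {}" "L \<in> unit_operators Y"
    and "\<And>j. j \<in> J \<Longrightarrow> 1 \<le> j \<and> X j \<subseteq> Y"
  shows "n1_index smul P J Y \<le> n1_op smul P J L"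
  unfolding n1_index_eq
proof (rule cINF_lower[OF _ assms(3)])
  show "bdd_below (n1_op smul P J ` unit_operators Y)"
    by (rule bdd_belowI2[of _ 0], rule n1_op_nonneg[OF assms(1,2) _ assms(4)])
      (auto simp: unit_operators_def)
qed

section \<open>Extension to the whole space\<close>

text \<open>Composing with the contraction \<open>P m\<close> cannot raise the norm, and the result
  agrees with \<open>L\<close> on \<open>X m\<close>, so the norm cannot drop either.\<close>

lemma extension_in_unit_operators:
  assumes m: "1 \<le> m" and L: "L \<in> unit_operators (X m)"
  shows "(\<lambda>x. L (P m x)) \<in> unit_operators UNIV"
proof -
  have blb: "bounded_linear_between smul smul (X m) (X m) L" and norm_L: "onorm_on (X m) L = 1"
    using L by (auto simp: unit_operators_def)
  have le: "norm (L (P m x)) \<le> norm x" for x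
    using onorm_on_bound[OF blb P_in_X[OF m], of x] norm_P_le[OF m, of x] norm_L by simp
  have ext: "bounded_linear_between smul smul UNIV UNIV (\<lambda>x. L (P m x))"
    unfolding bounded_linear_between_def
  proof (intro conjI ballI allI)
    show "\<exists>K. \<forall>x\<in>UNIV. norm (L (P m x)) \<le> norm x * K"
      using le by (intro exI[of _ 1]) simp
  qed (use blb P_in_X[OF m] P_smul[OF m] bounded_linear_P[OF m]
      in \<open>auto simp: bounded_linear_between_def linear_simps\<close>)
  have "onorm_on UNIV (\<lambda>x. L (P m x)) \<le> 1"
    using le by (intro onorm_on_le) auto
  moreover have "onorm_on (X m) L \<le> onorm_on UNIV (\<lambda>x. L (P m x))"
  proof (rule onorm_on_le)
    show "X m \<noteq> {}" using P_in_X[OF m] by blast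
    \<comment> \<open>\<open>onorm_on_le\<close> asks for a nonnegative bound; the sign of the norm
      is read off at a nonzero vector.\<close>
    obtain x where "x \<in> X m" "x \<noteq> 0" using X_nontrivial[OF m] .
    then have "0 \<le> onorm_on UNIV (\<lambda>x. L (P m x)) * norm x" "0 < norm x"
      using order_trans[OF norm_ge_zero onorm_on_bound[OF ext]] by auto
    then show "0 \<le> onorm_on UNIV (\<lambda>x. L (P m x))"
      by (simp add: zero_le_mult_iff)
    show "norm (L x) \<le> onorm_on UNIV (\<lambda>x. L (P m x)) * norm x" if "x \<in> X m" for x
      using onorm_on_bound[OF ext, of x] P_fixes[OF m order_refl that] by simp
  qed
  ultimately show ?thesis
    using ext norm_L by (simp add: unit_operators_def)
qed

text \<open>Compressing the extension by \<open>P j\<close> gives the compression of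
  \<open>L\<close> by \<open>P (min j m)\<close>. For \<open>j \<le> m\<close>, \<open>P m\<close>
  fixes the range of \<open>P j\<close>; for larger \<open>j\<close>, \<open>P m\<close> absorbs the
  inner \<open>P j\<close> and the outer one fixes \<open>X m\<close>.\<close>

lemma n1_index_UNIV_le:
  assumes m: "1 \<le> m" and states: "states \<noteq> {}"
  shows "n1_index smul P {1..} UNIV \<le> n1_index smul P {1..m} (X m)"
  unfolding n1_index_eq[of _ "{1..m}"]
proof (rule cINF_greatest)
  show "unit_operators (X m) \<noteq> {}" by (rule unit_operators_X_nonempty[OF m])
  fix L assume L: "L \<in> unit_operators (X m)"
  then have blb: "bounded_linear_between smul smul (X m) (X m) L"
    by (simp add: unit_operators_def)
  have "n1_index smul P {1..} UNIV \<le> n1_op smul P {1..} (\<lambda>x. L (P m x))"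
    by (rule n1_index_lower[OF _ states extension_in_unit_operators[OF m L]]) auto
  also have "\<dots> \<le> n1_op smul P {1..m} L"
  proof (rule n1_op_least[OF _ states])
    fix j f x assume "j \<in> {1::nat..}" and fx: "(f, x) \<in> states"
    then have j: "1 \<le> j" by simp
    define i where "i = min j m"
    have "P j (L (P m (P j x))) = P i (L (P i x))"
    proof (cases "j \<le> m")
      case True
      then show ?thesis
        using P_fixes[OF j True P_in_X[OF j]] by (simp add: i_def min_absorb1)
    next
      case False
      then have "L (P m x) \<in> X m" "m \<le> j"
        using blb P_in_X[OF m] by (auto simp: bounded_linear_between_def)
      then show ?thesis
        using P_absorb[OF m] P_fixes[OF m] by (simp add: i_def min_absorb2)
    qed
    moreover have "norm (f (P i (L (P i x)))) \<le> n1_op smul P {1..m} L"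
      by (rule n1_op_upper[OF blb _ _ fx]) (use m j X_mono in \<open>auto simp: i_def\<close>)
    ultimately show "norm (f (P j (L (P m (P j x))))) \<le> n1_op smul P {1..m} L"
      by simp
  qed simp
  finally show "n1_index smul P {1..} UNIV \<le> n1_op smul P {1..m} L" .
qed

section \<open>Compression to the subspaces\<close>

context
  fixes L
  assumes L: "L \<in> unit_operators UNIV"
begin

lemma blb_L: "bounded_linear_between smul smul UNIV UNIV L"
  using L by (simp add: unit_operators_def)

lemma bounded_linear_L: "bounded_linear L"
  using blb_L bounded_linear_between_UNIV[OF normed_space_over_axioms normed_space_over_axioms]
  by blast

lemma norm_L_le: "norm (L x) \<le> norm x"
  using onorm_on_bound[OF blb_L, of x] L by (simp add: unit_operators_def)

text \<open>The factor \<open>r\<close> serves two cases: \<open>r = 1\<close> gives the compression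
  itself, and the reciprocal of its norm gives the normalised one.\<close>

lemma scaled_compression_between:
  assumes m: "1 \<le> m"
  shows "bounded_linear_between smul smul (X m) (X m) (\<lambda>x. r *\<^sub>R P m (L x))"
  unfolding bounded_linear_between_def
proof (intro conjI ballI allI)
  show "(\<lambda>x. r *\<^sub>R P m (L x)) ` X m \<subseteq> X m"
    using P_in_X[OF m] subspace_scale[OF subspace_X[OF m]] by (auto simp flip: smul_of_real)
  show "r *\<^sub>R P m (L (x + y)) = r *\<^sub>R P m (L x) + r *\<^sub>R P m (L y)" for x y
    using bounded_linear_P[OF m] bounded_linear_L by (simp add: linear_simps algebra_simps)
  have "L (smul c x) = smul c (L x)" for c x
    using blb_L by (simp add: bounded_linear_between_def)
  then show "r *\<^sub>R P m (L (smul c x)) = smul c (r *\<^sub>R P m (L x))" for c x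
    by (simp add: P_smul[OF m] scale_left_commute flip: smul_of_real)
  have "norm (r *\<^sub>R P m (L x)) \<le> norm x * \<bar>r\<bar>" for x
    using order_trans[OF norm_P_le[OF m] norm_L_le]
    by (simp add: mult.commute[of "norm x"] mult_left_mono)
  then show "\<exists>K. \<forall>x\<in>X m. norm (r *\<^sub>R P m (L x)) \<le> norm x * K" by blast
qed

text \<open>A vector on which \<open>L\<close> stretches by more than \<open>d\<close> keeps this
  property after compression: \<open>P m x\<close> is a test vector in \<open>X m\<close>, and
  \<open>P m (L (P m x))\<close> tends to \<open>L x\<close>.\<close>

lemma compression_norm_eventually_gt:
  assumes "0 \<le> d" "d < 1"
  shows "\<forall>\<^sub>F m in sequentially. d < onorm_on (X m) (\<lambda>x. P m (L x))"
proof -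
  \<comment> \<open>Without such a vector \<open>d < 1\<close> would bound the norm of
    \<open>L\<close>.\<close>
  obtain x where x: "d * norm x < norm (L x)"
    using onorm_on_le[of UNIV d L] assms L by (force simp: unit_operators_def not_le[symmetric])
  have "(\<lambda>m. P m x - x) \<longlonglongrightarrow> 0"
    using P_tendsto by (simp add: LIM_zero)
  then have "(\<lambda>m. norm (L x - P m (L x)) + norm (P m x - x)) \<longlonglongrightarrow> 0 + 0"
    using P_tendsto[of "L x"]
    by (intro tendsto_add tendsto_norm_zero)
      (auto simp: LIM_zero tendsto_minus_cancel_left[symmetric] intro!: tendsto_eq_intros)
  then have "\<forall>\<^sub>F m in sequentially.
      norm (L x - P m (L x)) + norm (P m x - x) < norm (L x) - d * norm x"
    using x by (intro order_tendstoD(2)) auto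
  with eventually_ge_at_top[of 1] show ?thesis
  proof eventually_elim
    case (elim m)
    note m = elim(1)
    \<comment> \<open>The first two terms are the errors of replacing \<open>L x\<close> and
      \<open>x\<close> by their projections. Together they stay below the gap
      \<open>norm (L x) - d * norm x\<close>.\<close>
    have "L x = (L x - P m (L x)) - P m (L (P m x - x)) + P m (L (P m x))"
      using bounded_linear_P[OF m] bounded_linear_L by (simp add: linear_simps)
    then have "norm (L x) \<le> norm (L x - P m (L x)) + norm (P m (L (P m x - x)))
        + norm (P m (L (P m x)))"
      by (metis norm_triangle_ineq norm_triangle_ineq4 add_right_mono order_trans)
    moreover have "norm (P m (L (P m x - x))) \<le> norm (P m x - x)"
      using norm_P_le[OF m] norm_L_le order_trans by blast
    moreover have "d * norm (P m x) \<le> d * norm x"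
      using norm_P_le[OF m] assms(1) by (rule mult_left_mono)
    moreover have "norm (P m (L (P m x)))
        \<le> onorm_on (X m) (\<lambda>x. P m (L x)) * norm (P m x)"
      using onorm_on_bound[OF scaled_compression_between[OF m, of 1] P_in_X[OF m, of x]] by simp
    ultimately have "d * norm (P m x) < onorm_on (X m) (\<lambda>x. P m (L x)) * norm (P m x)"
      using elim(2) by linarith
    \<comment> \<open>The inequality is strict, so a factor known only to be nonnegative may be
      cancelled.\<close>
    then show ?case
      by (rule mult_right_less_imp_less) simp
  qed
qed

text \<open>The compression divided by its norm \<open>?t\<close> is a competitor for the infimum
  over \<open>X m\<close>. For \<open>j \<le> m\<close> the outer \<open>P j\<close> absorbs
  \<open>P m\<close>, so its values are those of \<open>L\<close> divided by
  \<open>?t\<close>.\<close>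

lemma n1_index_X_le:
  assumes m: "1 \<le> m" and states: "states \<noteq> {}"
    and pos: "0 < onorm_on (X m) (\<lambda>x. P m (L x))" (is "0 < ?t")
  shows "n1_index smul P {1..m} (X m) \<le> n1_op smul P {1..} L / ?t"
proof -
  let ?M = "\<lambda>x. (1 / ?t) *\<^sub>R P m (L x)"
  have M: "onorm_on (X m) ?M = 1"
  proof (rule antisym)
    have ne: "X m \<noteq> {}" using P_in_X[OF m] by blast
    have "norm (P m (L x)) \<le> ?t * norm x" if "x \<in> X m" for x
      using onorm_on_bound[OF scaled_compression_between[OF m, of 1] that] by simp
    then show "onorm_on (X m) ?M \<le> 1"
      using pos ne by (intro onorm_on_le) (auto simp: divide_simps mult.commute)
    \<comment> \<open>Undoing the normalisation turns the norm of \<open>?M\<close> times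
      \<open>?t\<close> into a bound for the unscaled compression; comparison with \<open>?t\<close>
      then gives the missing inequality.\<close>
    have bound: "norm (P m (L x)) \<le> onorm_on (X m) ?M * ?t * norm x" if "x \<in> X m" for x
      using onorm_on_bound[OF scaled_compression_between[OF m] that, of "1 / ?t"] pos
      by (simp add: divide_simps mult_ac)
    obtain x where x: "x \<in> X m" "x \<noteq> 0" using X_nontrivial[OF m] .
    have "0 \<le> onorm_on (X m) ?M * ?t * norm x"
      using order_trans[OF norm_ge_zero bound[OF x(1)]] .
    then have "0 \<le> onorm_on (X m) ?M * ?t"
      using x(2) by (simp add: zero_le_mult_iff)
    then have "?t \<le> onorm_on (X m) ?M * ?t"
      using bound ne by (intro onorm_on_le) auto
    then show "1 \<le> onorm_on (X m) ?M" using pos by simp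
  qed
  have "n1_index smul P {1..m} (X m) \<le> n1_op smul P {1..m} ?M"
    by (rule n1_index_lower[OF _ states])
      (use m X_mono scaled_compression_between[OF m] M in \<open>auto simp: unit_operators_def\<close>)
  also have "\<dots> \<le> n1_op smul P {1..} L / ?t"
  proof (rule n1_op_least[OF _ states])
    show "{1..m} \<noteq> {}" using m by simp
    fix j f x assume "j \<in> {1..m}" and fx: "(f, x) \<in> states"
    then have j: "1 \<le> j" "j \<le> m" by auto
    have "P j (?M (P j x)) = (1 / ?t) *\<^sub>R P j (L (P j x))"
      using bounded_linear_P[OF j(1)] P_absorb[OF j] by (simp add: linear_simps)
    moreover have "f \<in> dual_sphere smul" using fx by (simp add: states_def)
    ultimately have "norm (f (P j (?M (P j x)))) = norm (f (P j (L (P j x)))) / ?t"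
      using pos norm_dual_sphere_scaleR by simp
    also have "\<dots> \<le> n1_op smul P {1..} L / ?t"
      using pos by (intro divide_right_mono n1_op_upper[OF blb_L _ _ fx]) (use j in auto)
    finally show "norm (f (P j (?M (P j x)))) \<le> n1_op smul P {1..} L / ?t" .
  qed
  finally show ?thesis .
qed

end

section \<open>The limit\<close>

text \<open>Extension gives the lower estimate for every \<open>m \<ge> 1\<close>. For the upper
  one, a nearly optimal \<open>L\<close> on the whole space is compressed.\<close>

lemma n1_index_tendsto_if_states:
  assumes states: "states \<noteq> {}"
  shows "(\<lambda>m. n1_index smul P {1..m} (X m)) \<longlonglongrightarrow> n1_index smul P {1..} UNIV"
proof (rule order_tendstoI)
  fix a assume "a < n1_index smul P {1..} UNIV"
  then show "\<forall>\<^sub>F m in sequentially. a < n1_index smul P {1..m} (X m)"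
    using n1_index_UNIV_le[OF _ states] by (intro eventually_sequentiallyI[of 1]) fastforce
next
  fix c assume "n1_index smul P {1..} UNIV < c"
  then obtain L where L: "L \<in> unit_operators UNIV" and less: "n1_op smul P {1..} L < c"
    unfolding n1_index_eq using cInf_lessD[of "n1_op smul P {1..} ` unit_operators UNIV" c]
      unit_operators_UNIV_nonempty by auto
  have nonneg: "0 \<le> n1_op smul P {1..} L"
    by (rule n1_op_nonneg[OF _ states blb_L[OF L]]) auto
  \<comment> \<open>The threshold is chosen so that dividing the radius of \<open>L\<close> by a
    larger norm gives less than \<open>c\<close>. It lies in \<open>[0, 1)\<close> because the
    radius is nonnegative and below \<open>c\<close>.\<close>
  have "\<forall>\<^sub>F m in sequentially.
      n1_op smul P {1..} L / c < onorm_on (X m) (\<lambda>x. P m (L x))"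
    using nonneg less by (intro compression_norm_eventually_gt[OF L]) auto
  with eventually_ge_at_top[of 1]
  show "\<forall>\<^sub>F m in sequentially. n1_index smul P {1..m} (X m) < c"
  proof eventually_elim
    case (elim m)
    have pos: "0 < onorm_on (X m) (\<lambda>x. P m (L x))"
      using elim(2) nonneg less by (intro le_less_trans[OF _ elim(2)]) simp
    have "n1_op smul P {1..} L / onorm_on (X m) (\<lambda>x. P m (L x)) < c"
      using elim(2) pos nonneg less by (simp add: divide_simps mult.commute)
    with n1_index_X_le[OF L elim(1) states pos] show ?case by simp
  qed
qed

text \<open>
  Deciding whether a state exists would require the Hahn-Banach theorem. It is not needed:
  without states every \<^const>\<open>n1_op\<close> is the same value \<open>Sup {}\<close>.
\<close>

lemma n1_index_tendsto:
  "(\<lambda>m. n1_index smul P {1..m} (X m)) \<longlonglongrightarrow> n1_index smul P {1..} UNIV"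
proof (cases "states = {}")
  case True
  then have "n1_index smul P J Y = Sup {}" if "unit_operators Y \<noteq> {}" for J Y
    using that by (simp add: n1_index_eq n1_op_eq)
  then have "n1_index smul P {1..m} (X m) = n1_index smul P {1..} UNIV" if "1 \<le> m" for m
    using unit_operators_X_nonempty[OF that] unit_operators_UNIV_nonempty by simp
  then show ?thesis
    by (intro tendsto_eventually eventually_sequentiallyI)
qed (rule n1_index_tendsto_if_states)

end

theorem theorem2p3:
  fixes smul :: "'k::real_or_complex \<Rightarrow> 'a::banach \<Rightarrow> 'a"
    and X :: "nat \<Rightarrow> 'a set"
    and P :: "nat \<Rightarrow> 'a \<Rightarrow> 'a"
  assumes "normed_space_over smul"
    and "\<And>m. m \<ge> 1 \<Longrightarrow> module.subspace smul (X m)"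
    and "\<And>m. m \<ge> 1 \<Longrightarrow> closed (X m)"
    and "\<And>m. m \<ge> 1 \<Longrightarrow> X m \<subseteq> X (Suc m)"
    and "closure (\<Union>m\<in>{1..}. X m) = UNIV"
    and "\<And>m. m \<ge> 1 \<Longrightarrow> bounded_linear_between smul smul UNIV UNIV (P m)"
    and "\<And>m. m \<ge> 1 \<Longrightarrow> range (P m) = X m"
    and "\<And>m x. m \<ge> 1 \<Longrightarrow> P m (P m x) = P m x"
    and "\<And>m. m \<ge> 1 \<Longrightarrow> onorm (P m) = 1"
    and "\<And>m j x. m \<ge> 1 \<Longrightarrow> j \<ge> m \<Longrightarrow> P m (P j x) = P m x"
  shows "(\<lambda>m. n1_index smul P {1..m} (X m)) \<longlonglongrightarrow> n1_index smul P {1..} UNIV"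
proof -
  interpret normed_space_over smul by fact
  interpret projection_filtration smul X P
    by unfold_locales (use assms in auto)
  show ?thesis by (rule n1_index_tendsto)
qed

end
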